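(* Let $k\in\mathbb{R}$ and let $w_A,w_B:\mathbb{R}\to\mathbb{C}$ be $C^\infty$ functions with $w_A\neq\overline{w_B}$ and $w_A(x)+w_B(x)=x+k$ for all $x\in\mathbb{R}$. With $\varphi_0,\Psi_0$ and the differential operators $B$, $A^\dagger$ as in the context, let $$\varphi_n=\frac{1}{\sqrt{n!}}\,B^n\varphi_0,\qquad \Psi_n=\frac{1}{\sqrt{n!}}\,(A^\dagger)^n\Psi_0,\qquad n\geq 0.$$ Then, for all $n,m\geq0$, $\varphi_n\,\overline{\Psi_m}\in L^1(\mathbb{R})$ and $\langle\Psi_m,\varphi_n\rangle=\delta_{n,m}$.
   Context: For measurable functions $f,g$ on $\mathbb{R}$ with $\overline{f}\,g\in L^1(\mathbb{R})$, write $\langle f,g\rangle=\int_{\mathbb{R}}\overline{f(x)}\,g(x)\,dx$, even if $f$ or $g$ is not in $L^2(\mathbb{R})$. The operators $B=-\frac{d}{dx}+w_B(x)$ and $A^\dagger=-\frac{d}{dx}+\overline{w_A(x)}$ act as differential expressions on $C^\infty$ functions $\mathbb{R}\to\mathbb{C}$ (no square-integrability is required). Let $s_A,s_B$ be primitives of $w_A,w_B$ (so $s_A'=w_A$, $s_B'=w_B$), with integration constants chosen so that $s_A(x)+s_B(x)=\frac{x^2}{2}+kx$. Then $$\varphi_0(x)=N_\varphi\,e^{-s_A(x)},\qquad \Psi_0(x)=N_\Psi\,e^{-\overline{s_B(x)}},$$ where $N_\varphi,N_\Psi\in\mathbb{C}$ are nonzero constants with $N_\varphi\overline{N_\Psi}=\frac{e^{-k^2/2}}{\sqrt{2\pi}}$.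 *)

theory Defs
  imports "HOL-Analysis.Analysis"
begin

abbreviation D :: "(real \<Rightarrow> complex) \<Rightarrow> real \<Rightarrow> complex"
  where "D f \<equiv> \<lambda>x. vector_derivative f (at x)"

text \<open>Smoothness (class $C^\infty$): every iterated derivative is differentiable everywhere.
  Since \<^const>\<open>vector_derivative\<close> is total, the iterate \<open>(D ^^ n) f\<close> is the genuine
  \<open>n\<close>-th derivative exactly when all the lower ones are differentiable,
  which the quantification over \<open>n\<close> provides.\<close>
definition smooth :: "(real \<Rightarrow> complex) \<Rightarrow> bool"
  where "smooth f \<longleftrightarrow> (\<forall>n x. (D ^^ n) f differentiable (at x))"

definition op_B :: "(real \<Rightarrow> complex) \<Rightarrow> (real \<Rightarrow> complex) \<Rightarrow> real \<Rightarrow> complex"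
  where "op_B w\<^sub>B f = (\<lambda>x. - D f x + w\<^sub>B x * f x)"

definition op_A_dagger :: "(real \<Rightarrow> complex) \<Rightarrow> (real \<Rightarrow> complex) \<Rightarrow> real \<Rightarrow> complex"
  where "op_A_dagger w\<^sub>A f = (\<lambda>x. - D f x + cnj (w\<^sub>A x) * f x)"

text \<open>Conjugate-linear in the first argument; \<open>f\<close> and \<open>g\<close> themselves need not be
  square-integrable. The value is meaningful only if the integrand is integrable.\<close>
definition pairing :: "(real \<Rightarrow> complex) \<Rightarrow> (real \<Rightarrow> complex) \<Rightarrow> complex"
  where "pairing f g = (LINT x|lebesgue. cnj (f x) * g x)"

definition phi0 :: "complex \<Rightarrow> (real \<Rightarrow> complex) \<Rightarrow> real \<Rightarrow> complex"
  where "phi0 N s\<^sub>A = (\<lambda>x. N * exp (- s\<^sub>A x))"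

definition Psi0 :: "complex \<Rightarrow> (real \<Rightarrow> complex) \<Rightarrow> real \<Rightarrow> complex"
  where "Psi0 N s\<^sub>B = (\<lambda>x. N * exp (- cnj (s\<^sub>B x)))"

definition phi :: "complex \<Rightarrow> (real \<Rightarrow> complex) \<Rightarrow> (real \<Rightarrow> complex) \<Rightarrow> nat \<Rightarrow> real \<Rightarrow> complex"
  where "phi N s\<^sub>A w\<^sub>B n = (\<lambda>x. (op_B w\<^sub>B ^^ n) (phi0 N s\<^sub>A) x / complex_of_real (sqrt (fact n)))"

definition Psi :: "complex \<Rightarrow> (real \<Rightarrow> complex) \<Rightarrow> (real \<Rightarrow> complex) \<Rightarrow> nat \<Rightarrow> real \<Rightarrow> complex"
  where "Psi N s\<^sub>B w\<^sub>A n = (\<lambda>x. (op_A_dagger w\<^sub>A ^^ n) (Psi0 N s\<^sub>B) x / complex_of_real (sqrt (fact n)))"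

end

theory Submission
  imports Defs "HOL-Probability.Distributions" "HOL-Computational_Algebra.Polynomial"
begin

text \<open>Every \<open>f = p(x + k) g\<close> with \<open>g' = -u g\<close> is sent by \<open>-d/dx + w\<close>, where \<open>u + w = x + k\<close>, to
  \<open>((x + k) p - p') g\<close>. Hence \<open>\<phi>\<^sub>n\<close> and \<open>\<Psi>\<^sub>n\<close> are the same Hermite polynomial \<open>He\<^sub>n(x + k) / \<surd>n!\<close> times
  \<open>\<phi>\<^sub>0\<close> and \<open>\<Psi>\<^sub>0\<close>, and \<open>\<phi>\<^sub>0\<close> times the conjugate of \<open>\<Psi>\<^sub>0\<close> is the standard normal density at \<open>x + k\<close>.
  The claim is therefore the orthogonality of the Hermite polynomials, which follows from
  \<open>E[X p(X)] = E[p'(X)]\<close> for a standard normal variable \<open>X\<close>.\<close>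

text \<open>Taking polynomials as arguments makes integrability automatic, so linearity carries no
  side conditions.\<close>

definition gauss_mean :: "real poly \<Rightarrow> real"
  where "gauss_mean p = (\<integral>x. std_normal_density x * poly p x \<partial>lborel)"

lemma integrable_std_normal_poly: "integrable lborel (\<lambda>x. std_normal_density x * poly p x)"
proof -
  have "integrable lborel (\<lambda>x. \<Sum>i\<le>degree p. coeff p i * (std_normal_density x * x ^ i))"
    by (intro Bochner_Integration.integrable_sum integrable_mult_right integrable_std_normal_moment)
  then show ?thesis
    by (simp add: poly_altdef sum_distrib_left mult.left_commute)
qed

lemma gauss_mean_add: "gauss_mean (p + q) = gauss_mean p + gauss_mean q"
  using integrable_std_normal_poly by (simp add: gauss_mean_def distrib_left)

lemma gauss_mean_diff: "gauss_mean (p - q) = gauss_mean p - gauss_mean q"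
  using integrable_std_normal_poly by (simp add: gauss_mean_def right_diff_distrib)

lemma gauss_mean_smult: "gauss_mean (smult c p) = c * gauss_mean p"
  by (simp add: gauss_mean_def mult.left_commute)

lemma gauss_mean_0 [simp]: "gauss_mean 0 = 0"
  by (simp add: gauss_mean_def)

lemma gauss_mean_1 [simp]: "gauss_mean 1 = 1"
  by (simp add: gauss_mean_def)

text \<open>Even moments have a closed form, whose consecutive quotients give the factor; odd
  moments vanish on both sides.\<close>

lemma gauss_mean_monom_Suc_Suc:
  "gauss_mean (monom 1 (Suc (Suc j))) = real (Suc j) * gauss_mean (monom 1 j)"
proof (cases "even j")
  case True
  then obtain i where j: "j = 2 * i" by (rule evenE)
  have even: "gauss_mean (monom 1 (2 * i)) = fact (2 * i) / (2 ^ i * fact i)" for i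
    using integral_std_normal_moment_even[of i] by (simp add: gauss_mean_def poly_monom)
  have "gauss_mean (monom 1 (Suc (Suc j))) = fact (2 * Suc i) / (2 ^ Suc i * fact (Suc i))"
    using even[of "Suc i"] by (simp add: j)
  also have "\<dots> = real (Suc j) * (fact (2 * i) / (2 ^ i * fact i))"
    by (simp add: j divide_simps)
  finally show ?thesis
    by (simp only: even j)
next
  case False
  then obtain i where j: "j = 2 * i + 1" by (rule oddE)
  show ?thesis
    using integral_std_normal_moment_odd[of i] integral_std_normal_moment_odd[of "Suc i"]
    by (simp add: gauss_mean_def poly_monom j)
qed

lemma gauss_mean_monom_1: "gauss_mean (monom 1 (Suc 0)) = 0"
  using integral_std_normal_moment_odd[of 0] by (simp add: gauss_mean_def poly_monom)

text \<open>Stein's identity: \<open>pCons 0\<close> is multiplication by the variable. By linearity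
  it reduces to the moment recursion, which avoids integration by parts.\<close>

lemma gauss_mean_pCons_0: "gauss_mean (pCons 0 p) = gauss_mean (pderiv p)"
proof -
  have monom: "gauss_mean (pCons 0 (monom c i)) = gauss_mean (pderiv (monom c i))" for c i
  proof -
    \<comment> \<open>For \<open>i = 0\<close> the truncated \<open>i - 1\<close> is harmless, since
      the coefficient \<open>real i\<close> is zero.\<close>
    have "gauss_mean (monom 1 (Suc i)) = gauss_mean (monom (real i) (i - 1))"
    proof (cases i)
      case 0
      then show ?thesis by (simp add: gauss_mean_monom_1)
    next
      case (Suc j)
      have "monom (real i) (i - 1) = smult (real (Suc j)) (monom 1 j)"
        by (simp add: Suc smult_monom)
      then show ?thesis
        by (simp only: Suc gauss_mean_monom_Suc_Suc gauss_mean_smult)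
    qed
    then have "gauss_mean (smult c (monom 1 (Suc i))) = gauss_mean (smult c (monom (real i) (i - 1)))"
      by (simp only: gauss_mean_smult)
    then show ?thesis
      by (simp add: smult_monom pderiv_monom monom_Suc[symmetric] mult.commute)
  qed
  \<comment> \<open>Arbitrary finite \<open>A\<close> lets the induction add one monomial at a time
    while \<open>p\<close> stays fixed.\<close>
  have "gauss_mean (pCons 0 (\<Sum>i\<in>A. monom (coeff p i) i)) =
      gauss_mean (pderiv (\<Sum>i\<in>A. monom (coeff p i) i))" if "finite A" for A
    using that
  proof induction
    case (insert a A)
    have "pCons 0 (q + r) = pCons 0 q + pCons 0 r" for q r :: "real poly" by simp
    with insert show ?case
      by (simp only: sum.insert[OF insert.hyps] pderiv_add gauss_mean_add monom)
  qed simp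
  from this[of "{..degree p}"] show ?thesis
    by (simp add: poly_as_sum_of_monoms)
qed

text \<open>The probabilists' Hermite polynomials, by the recursion that mirrors one application of
  either operator.\<close>

fun hermite :: "nat \<Rightarrow> real poly"
  where
    "hermite 0 = 1"
  | "hermite (Suc n) = pCons 0 (hermite n) - pderiv (hermite n)"

text \<open>Differentiating the recursion yields one copy of \<open>hermite (Suc n)\<close> from the
  product rule; by induction the rest is \<open>Suc n\<close> times the recursion for that same
  polynomial.\<close>

lemma pderiv_hermite: "pderiv (hermite (Suc n)) = smult (real (Suc n)) (hermite n)"
proof (induction n)
  case 0
  then show ?case by (simp add: pderiv_pCons)
next
  case (Suc n)
  have "pderiv (hermite (Suc (Suc n))) = hermite (Suc n) +
      (pCons 0 (pderiv (hermite (Suc n))) - pderiv (pderiv (hermite (Suc n))))"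
    by (simp only: hermite.simps(2)[of "Suc n"] pderiv_diff pderiv_pCons add_diff_eq)
  also have "\<dots> = hermite (Suc n) + smult (real (Suc n)) (hermite (Suc n))"
    unfolding Suc.IH by (simp add: pderiv_smult smult_diff_right)
  also have "\<dots> = smult (real (Suc (Suc n))) (hermite (Suc n))"
    by (simp only: of_nat_Suc[of "Suc n"] smult_add_left smult_1_left)
  finally show ?case .
qed

text \<open>The raising step is adjoint to differentiation: in Stein's identity for
  \<open>p * hermite m\<close>, the term with \<open>pderiv (hermite m)\<close> cancels.\<close>

lemma gauss_mean_hermite_Suc:
  "gauss_mean (p * hermite (Suc m)) = gauss_mean (pderiv p * hermite m)"
proof -
  have "p * hermite (Suc m) = pCons 0 (p * hermite m) - p * pderiv (hermite m)"
    by (simp add: right_diff_distrib)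
  then show ?thesis
    by (simp add: gauss_mean_diff gauss_mean_pCons_0 pderiv_mult gauss_mean_add mult.commute)
qed

text \<open>Adjointness lowers both indices together, gaining the factor \<open>n\<close>. Equal
  indices end at the mean of 1, unequal ones at the mean of a single \<open>hermite (Suc _)\<close>,
  which is 0.\<close>

lemma gauss_mean_hermite_mult:
  "gauss_mean (hermite n * hermite m) = (if n = m then fact n else 0)"
proof (induction m arbitrary: n)
  case 0
  show ?case
    by (cases n) (simp_all add: gauss_mean_diff gauss_mean_pCons_0)
next
  case (Suc m)
  show ?case
  proof (cases n)
    case 0
    then show ?thesis
      using gauss_mean_hermite_Suc[of 1 m] by (simp del: hermite.simps(2))
  next
    case (Suc j)
    then show ?thesis
      by (simp add: gauss_mean_hermite_Suc pderiv_hermite gauss_mean_smult Suc.IH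
          del: hermite.simps(2) of_nat_Suc)
  qed
qed

text \<open>Only the sum of \<open>u\<close> and \<open>w\<close> matters, so one lemma serves both
  operators: \<open>u\<close> is \<open>w\<^sub>A\<close> for \<phi> and the conjugate of
  \<open>w\<^sub>B\<close> for \<Psi>.\<close>

lemma op_B_funpow_hermite:
  assumes g: "\<And>x. (g has_vector_derivative - u x * g x) (at x)"
    and uw: "\<And>x. u x + w x = complex_of_real (x + k)"
  shows "(op_B w ^^ n) g = (\<lambda>x. of_real (poly (hermite n) (x + k)) * g x)"
proof (induction n)
  case (Suc n)
  let ?h = "\<lambda>x. poly (hermite n) (x + k)" and ?h' = "\<lambda>x. poly (pderiv (hermite n)) (x + k)"
  have D: "D (\<lambda>x. of_real (?h x) * g x) x = of_real (?h' x) * g x - of_real (?h x) * u x * g x" for x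
  proof -
    have "(?h has_real_derivative ?h' x) (at x)"
      using DERIV_chain2[OF poly_DERIV, of "\<lambda>x. x + k" 1 x] by (auto intro!: derivative_eq_intros)
    then have "((\<lambda>x. complex_of_real (?h x)) has_vector_derivative of_real (?h' x)) (at x)"
      by (intro has_vector_derivative_of_real) (simp add: has_real_derivative_iff_has_vector_derivative)
    from has_vector_derivative_mult[OF this g] show ?thesis
      by (intro vector_derivative_at) (simp add: algebra_simps)
  qed
  show ?case
  proof
    fix x
    have "(op_B w ^^ Suc n) g x =
        of_real (?h x) * (u x + w x) * g x - of_real (?h' x) * g x"
      unfolding funpow.simps o_apply Suc.IH op_B_def D by (simp add: algebra_simps)
    also have "\<dots> = of_real (poly (hermite (Suc n)) (x + k)) * g x"
      by (simp add: uw algebra_simps)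
    finally show "(op_B w ^^ Suc n) g x = of_real (poly (hermite (Suc n)) (x + k)) * g x" .
  qed
qed simp

lemma op_A_dagger_eq_op_B: "op_A_dagger w = op_B (\<lambda>x. cnj (w x))"
  by (simp add: fun_eq_iff op_A_dagger_def op_B_def)

lemma has_vector_derivative_const_mult_exp_minus:
  fixes s :: "real \<Rightarrow> complex"
  assumes "(s has_vector_derivative s') (at x)"
  shows "((\<lambda>x. N * exp (- s x)) has_vector_derivative - s' * (N * exp (- s x))) (at x)"
proof -
  have "((\<lambda>z. N * exp (- z)) has_field_derivative - (N * exp (- s x))) (at (s x))"
    by (auto intro!: derivative_eq_intros)
  from field_vector_diff_chain_at[OF assms this] show ?thesis
    by (simp add: o_def)
qed

theorem proposition5:
  fixes k :: real
    and w\<^sub>A w\<^sub>B s\<^sub>A s\<^sub>B :: "real \<Rightarrow> complex"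
    and N\<^sub>\<phi> N\<^sub>\<Psi> :: complex
  assumes "smooth w\<^sub>A" and "smooth w\<^sub>B"
    and "w\<^sub>A \<noteq> (\<lambda>x. cnj (w\<^sub>B x))"
    and "\<And>x. w\<^sub>A x + w\<^sub>B x = complex_of_real (x + k)"
    and "\<And>x. (s\<^sub>A has_vector_derivative w\<^sub>A x) (at x)"
    and "\<And>x. (s\<^sub>B has_vector_derivative w\<^sub>B x) (at x)"
    and "\<And>x. s\<^sub>A x + s\<^sub>B x = complex_of_real (x\<^sup>2 / 2 + k * x)"
    and "N\<^sub>\<phi> \<noteq> 0" and "N\<^sub>\<Psi> \<noteq> 0"
    and "N\<^sub>\<phi> * cnj N\<^sub>\<Psi> = complex_of_real (exp (- k\<^sup>2 / 2) / sqrt (2 * pi))"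
  shows "\<forall>n m. integrable lebesgue (\<lambda>x. phi N\<^sub>\<phi> s\<^sub>A w\<^sub>B n x * cnj (Psi N\<^sub>\<Psi> s\<^sub>B w\<^sub>A m x)) \<and>
    pairing (Psi N\<^sub>\<Psi> s\<^sub>B w\<^sub>A m) (phi N\<^sub>\<phi> s\<^sub>A w\<^sub>B n) = (if n = m then 1 else 0)"
proof (intro allI)
  fix n m
  have wA: "cnj (w\<^sub>B x) + cnj (w\<^sub>A x) = complex_of_real (x + k)" for x
    using arg_cong[OF assms(4)[of x], of cnj] by (simp add: add.commute)
  have phi: "phi N\<^sub>\<phi> s\<^sub>A w\<^sub>B n x = of_real (poly (hermite n) (x + k) / sqrt (fact n)) * (N\<^sub>\<phi> * exp (- s\<^sub>A x))" for x
    unfolding phi_def phi0_def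
    by (subst op_B_funpow_hermite[OF has_vector_derivative_const_mult_exp_minus[OF assms(5)] assms(4)]) simp
  have Psi: "Psi N\<^sub>\<Psi> s\<^sub>B w\<^sub>A m x =
      of_real (poly (hermite m) (x + k) / sqrt (fact m)) * (N\<^sub>\<Psi> * exp (- cnj (s\<^sub>B x)))" for x
    unfolding Psi_def Psi0_def op_A_dagger_eq_op_B
    by (subst op_B_funpow_hermite[OF has_vector_derivative_const_mult_exp_minus[OF
          has_vector_derivative_cnj[OF assms(6)]] wA]) simp
  \<comment> \<open>The outer conjugation undoes the one on \<open>s\<^sub>B\<close>, so the
    exponents add up; the factor \<open>exp (- k\<^sup>2 / 2)\<close> in the normalisation completes
    the square.\<close>
  have ground: "N\<^sub>\<phi> * exp (- s\<^sub>A x) * cnj (N\<^sub>\<Psi> * exp (- cnj (s\<^sub>B x))) = of_real (std_normal_density (x + k))" for x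
  proof -
    have "N\<^sub>\<phi> * exp (- s\<^sub>A x) * cnj (N\<^sub>\<Psi> * exp (- cnj (s\<^sub>B x))) =
        N\<^sub>\<phi> * cnj N\<^sub>\<Psi> * exp (- (s\<^sub>A x + s\<^sub>B x))"
      by (simp add: exp_cnj flip: exp_add)
    also have "\<dots> = of_real (exp (- k\<^sup>2 / 2) / sqrt (2 * pi) * exp (- (x\<^sup>2 / 2 + k * x)))"
      unfolding assms(7,10) of_real_minus[symmetric] exp_of_real of_real_mult ..
    also have "exp (- k\<^sup>2 / 2) / sqrt (2 * pi) * exp (- (x\<^sup>2 / 2 + k * x)) = std_normal_density (x + k)"
    proof -
      have "- (x + k)\<^sup>2 / 2 = - k\<^sup>2 / 2 + - (x\<^sup>2 / 2 + k * x)"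
        by (simp add: power2_eq_square field_simps)
      then show ?thesis
        unfolding std_normal_density_def by (simp only: exp_add) simp
    qed
    finally show ?thesis .
  qed
  define c where "c = sqrt (fact n) * sqrt (fact m :: real)"
  define F where "F x = std_normal_density x * poly (hermite n * hermite m) x / c" for x
  \<comment> \<open>The argument is written \<open>k + 1 * x\<close> to fit the affine substitution
    rule for \<open>lborel\<close>.\<close>
  have prod: "phi N\<^sub>\<phi> s\<^sub>A w\<^sub>B n x * cnj (Psi N\<^sub>\<Psi> s\<^sub>B w\<^sub>A m x) = complex_of_real (F (k + 1 * x))" for x
  proof -
    have "phi N\<^sub>\<phi> s\<^sub>A w\<^sub>B n x * cnj (Psi N\<^sub>\<Psi> s\<^sub>B w\<^sub>A m x) =
        of_real (poly (hermite n) (x + k) / sqrt (fact n)) *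
        of_real (poly (hermite m) (x + k) / sqrt (fact m)) *
        (N\<^sub>\<phi> * exp (- s\<^sub>A x) * cnj (N\<^sub>\<Psi> * exp (- cnj (s\<^sub>B x))))"
      by (simp add: phi Psi)
    also have "\<dots> = complex_of_real (F (k + 1 * x))"
      unfolding ground by (simp add: F_def c_def add.commute)
    finally show ?thesis .
  qed
  have F: "has_bochner_integral lborel F (if n = m then 1 else 0)"
  proof -
    have "has_bochner_integral lborel F (gauss_mean (hermite n * hermite m) / c)"
      unfolding F_def gauss_mean_def
      by (intro has_bochner_integral_divide_zero has_bochner_integral_integrable
          integrable_std_normal_poly)
    then show ?thesis
      by (cases "n = m") (simp_all add: gauss_mean_hermite_mult c_def)
  qed
  then have "has_bochner_integral lborel (\<lambda>x. F (k + 1 * x)) (if n = m then 1 else 0)"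
    by (subst (asm) lborel_has_bochner_integral_real_affine_iff[of 1 _ _ k]) simp_all
  then have I: "has_bochner_integral lborel (\<lambda>x. complex_of_real (F (k + 1 * x)))
      (of_real (if n = m then 1 else 0))"
    by (rule has_bochner_integral_of_real)
  \<comment> \<open>Borel measurability is what lets integrability and the integral pass from
    \<open>lborel\<close> to its completion \<open>lebesgue\<close>.\<close>
  have meas: "(\<lambda>x. complex_of_real (F (k + 1 * x))) \<in> borel_measurable lborel"
    using I by (rule borel_measurable_has_bochner_integral)
  have "integrable lebesgue (\<lambda>x. phi N\<^sub>\<phi> s\<^sub>A w\<^sub>B n x * cnj (Psi N\<^sub>\<Psi> s\<^sub>B w\<^sub>A m x))"
    unfolding prod integrable_completion[OF meas] using I by (rule integrable.intros)
  moreover have "pairing (Psi N\<^sub>\<Psi> s\<^sub>B w\<^sub>A m) (phi N\<^sub>\<phi> s\<^sub>A w\<^sub>B n) = (if n = m then 1 else 0)"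
    unfolding pairing_def mult.commute[of "cnj _"] prod integral_completion[OF meas]
    using has_bochner_integral_integral_eq[OF I] by simp
  ultimately show "integrable lebesgue (\<lambda>x. phi N\<^sub>\<phi> s\<^sub>A w\<^sub>B n x * cnj (Psi N\<^sub>\<Psi> s\<^sub>B w\<^sub>A m x)) \<and>
      pairing (Psi N\<^sub>\<Psi> s\<^sub>B w\<^sub>A m) (phi N\<^sub>\<phi> s\<^sub>A w\<^sub>B n) = (if n = m then 1 else 0)"
    by blast
qed

end
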